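(* Let $G$ be a finite group and let $Max_G=\{x_1,\dots,x_m\}$ be an essential cyclic set of $G$ with $m\geq 3$. If $icn(G)=1$, then $rc(\Gamma_G^e)=3$ if and only if $G$ does not have an awning.
   Context: Let $G$ be a finite group with identity $e$. The enhanced power graph $\Gamma_G^e$ has vertex set $G$, two distinct vertices $x,y$ being adjacent iff $x,y\in\langle z\rangle$ for some $z\in G$. For a connected graph $\Gamma$, an edge-colouring $\zeta:E(\Gamma)\to\{1,\dots,k\}$ (not necessarily proper) is a rainbow $k$-colouring if every pair of distinct vertices is joined by a path whose edges have pairwise distinct colours; $rc(\Gamma)$ is the minimum such $k$. An essential cyclic set $Max_G=\{x_1,\dots,x_m\}$ is a set of elements of $G$ such that $\langle x_1\rangle,\dots,\langle x_m\rangle$ are pairwise distinct and are exactly the maximal cyclic subgroups of $G$. The independence cyclic set is $ics(G)=\{x_i\in Max_G:\langle x_i\rangle\cap\langle x_j\rangle=\{e\}\text{ for all }j\neq i\}$ and $icn(G)=|ics(G)|$. Awning: given an ordering $x_1,\dots,x_m$ of $Max_G$, an awning is a family of indexed sets $H_1,\dots,H_{m-1}$, where $H_i=\{h_{i,i+1},\dots,h_{i,m}\}\subseteq\langle x_i\rangle$ is partitioned as $H_i=A_i\,\dot\cup\,B_i$, such that (1) $h_{i,j}\in\langle x_i\rangle\cap\langle x_j\rangle$ for all $i<j$; (2) whenever $i<j$, $2\le j\le m-1$, $s\in\{j+1,\dots,m\}$, $r\in\{i+1,\dots,m\}$ and $h_{j,s}=h_{i,r}$: (a) if $r=j$ and $h_{i,r}\in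 A_i$ then $h_{j,s}\in B_j$; (b) if $r=j$ and $h_{i,r}\in B_i$ then $h_{j,s}\in A_j$; (c) if $r=s>j$ and $h_{i,r}\in A_i$ then $h_{j,r}\in A_j$; (d) if $r=s>j$ and $h_{i,r}\in B_i$ then $h_{j,r}\in B_j$. $G$ has an awning if an awning exists for some ordering of $Max_G$. *)

theory Defs
  imports
    "HOL-Algebra.Generated_Groups"
    "Graph_Theory.Pair_Digraph"
    "Graph_Theory.Vertex_Walk"
begin

text \<open>
  Undirected graphs are symmetric loop-free digraphs, as in the library (\<^locale>\<open>pair_graph\<close>).
  An edge is the two-element set of its end points, so that an edge colouring gives the same
  colour to both orientations of an arc.
\<close>

definition uedges :: "'a pair_pre_digraph \<Rightarrow> 'a set set" where
  "uedges \<Gamma> = (\<lambda>(u, v). {u, v}) ` parcs \<Gamma>"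

definition rainbow_path :: "'a pair_pre_digraph \<Rightarrow> ('a set \<Rightarrow> nat) \<Rightarrow> 'a list \<Rightarrow> bool" where
  "rainbow_path \<Gamma> \<zeta> p \<longleftrightarrow>
     vpath p (with_proj \<Gamma>) \<and> distinct (map (\<lambda>(u, v). \<zeta> {u, v}) (vwalk_arcs p))"

definition rainbow_colouring :: "'a pair_pre_digraph \<Rightarrow> nat \<Rightarrow> ('a set \<Rightarrow> nat) \<Rightarrow> bool" where
  "rainbow_colouring \<Gamma> k \<zeta> \<longleftrightarrow>
     \<zeta> ` uedges \<Gamma> \<subseteq> {1..k} \<and>
     (\<forall>u\<in>pverts \<Gamma>. \<forall>v\<in>pverts \<Gamma>. u \<noteq> v \<longrightarrow>
        (\<exists>p. rainbow_path \<Gamma> \<zeta> p \<and> hd p = u \<and> last p = v))"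

text \<open>
  Meaningful for finite connected graphs only: otherwise there may be no rainbow colouring at all.
\<close>

definition rc :: "'a pair_pre_digraph \<Rightarrow> nat" where
  "rc \<Gamma> = (LEAST k. \<exists>\<zeta>. rainbow_colouring \<Gamma> k \<zeta>)"

definition enhanced_power_graph :: "('a, 'b) monoid_scheme \<Rightarrow> 'a pair_pre_digraph" where
  "enhanced_power_graph G =
     \<lparr> pverts = carrier G,
       parcs = {(x, y). x \<in> carrier G \<and> y \<in> carrier G \<and> x \<noteq> y \<and>
                  (\<exists>z\<in>carrier G. x \<in> generate G {z} \<and> y \<in> generate G {z})} \<rparr>"

definition cyclic_subgroups :: "('a, 'b) monoid_scheme \<Rightarrow> 'a set set" where
  "cyclic_subgroups G = (\<lambda>x. generate G {x}) ` carrier G"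

definition maximal_cyclic_subgroups :: "('a, 'b) monoid_scheme \<Rightarrow> 'a set set" where
  "maximal_cyclic_subgroups G =
     {C \<in> cyclic_subgroups G. \<forall>D\<in>cyclic_subgroups G. C \<subseteq> D \<longrightarrow> C = D}"

definition essential_cyclic_set :: "('a, 'b) monoid_scheme \<Rightarrow> 'a set \<Rightarrow> bool" where
  "essential_cyclic_set G M \<longleftrightarrow>
     M \<subseteq> carrier G \<and> bij_betw (\<lambda>x. generate G {x}) M (maximal_cyclic_subgroups G)"

definition ics :: "('a, 'b) monoid_scheme \<Rightarrow> 'a set \<Rightarrow> 'a set" where
  "ics G M = {x \<in> M. \<forall>y\<in>M. y \<noteq> x \<longrightarrow> generate G {x} \<inter> generate G {y} = {\<one>\<^bsub>G\<^esub>}}"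

definition icn :: "('a, 'b) monoid_scheme \<Rightarrow> 'a set \<Rightarrow> nat" where
  "icn G M = card (ics G M)"

text \<open>
  The parts \<open>A i\<close> and \<open>B i\<close> partition the set of values of \<open>h i\<close>, that is, they consist of group
  elements rather than of indices; equal values \<open>h i j = h i k\<close> lie in the same part, and a part
  may be empty.
\<close>

definition awning ::
  "('a, 'b) monoid_scheme \<Rightarrow> nat \<Rightarrow> (nat \<Rightarrow> 'a) \<Rightarrow> (nat \<Rightarrow> nat \<Rightarrow> 'a) \<Rightarrow>
   (nat \<Rightarrow> 'a set) \<Rightarrow> (nat \<Rightarrow> 'a set) \<Rightarrow> bool" where
  "awning G m x h A B \<longleftrightarrow>
     (\<forall>i\<in>{1..m-1}.
        h i ` {i+1..m} \<subseteq> generate G {x i} \<and>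
        h i ` {i+1..m} = A i \<union> B i \<and> A i \<inter> B i = {}) \<and>
     (\<forall>i\<in>{1..m-1}. \<forall>j\<in>{i+1..m}. h i j \<in> generate G {x i} \<inter> generate G {x j}) \<and>
     (\<forall>j\<in>{2..m-1}. \<forall>i\<in>{1..<j}. \<forall>s\<in>{j+1..m}. \<forall>r\<in>{i+1..m}. h j s = h i r \<longrightarrow>
        (r = j \<and> h i r \<in> A i \<longrightarrow> h j s \<in> B j) \<and>
        (r = j \<and> h i r \<in> B i \<longrightarrow> h j s \<in> A j) \<and>
        (r = s \<and> h i r \<in> A i \<longrightarrow> h j r \<in> A j) \<and>
        (r = s \<and> h i r \<in> B i \<longrightarrow> h j r \<in> B j))"

definition has_awning :: "('a, 'b) monoid_scheme \<Rightarrow> 'a set \<Rightarrow> bool" where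
  "has_awning G M \<longleftrightarrow>
     (\<exists>x h A B. bij_betw x {1..card M} M \<and> awning G (card M) x h A B)"

lemma (in group) pair_graph_enhanced_power_graph:
  assumes "finite (carrier G)"
  shows "pair_graph (enhanced_power_graph G)"
proof
  show "finite (parcs (enhanced_power_graph G))"
    by (rule finite_subset[of _ "carrier G \<times> carrier G"])
       (auto simp: enhanced_power_graph_def assms)
qed (auto simp: enhanced_power_graph_def assms symmetric_def sym_def)

lemma (in group) ex_rainbow_colouring:
  assumes fin: "finite (carrier G)"
  shows "\<exists>k \<zeta>. rainbow_colouring (enhanced_power_graph G) k \<zeta>"
proof -
  let ?\<Gamma> = "enhanced_power_graph G"
  interpret pair_graph ?\<Gamma> by (rule pair_graph_enhanced_power_graph[OF fin])
  have "finite (uedges ?\<Gamma>)" by (simp add: uedges_def)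
  then obtain \<zeta> :: "'a set \<Rightarrow> nat" and k
    where im: "\<zeta> ` uedges ?\<Gamma> = {i. i < k}" and inj: "inj_on \<zeta> (uedges ?\<Gamma>)"
    using finite_imp_inj_to_nat_seg by metis
  let ?c = "\<lambda>e. Suc (\<zeta> e)"
  have arc: "(x, y) \<in> parcs ?\<Gamma>" if "x \<in> carrier G" "y \<in> carrier G" "x \<noteq> y" "y = \<one> \<or> x = \<one>" for x y
    using that generate.one[of G] generate.incl[of _ "{_}" G]
    by (auto simp: enhanced_power_graph_def)
  have edge: "{x, y} \<in> uedges ?\<Gamma>" if "(x, y) \<in> parcs ?\<Gamma>" for x y
    using that by (force simp: uedges_def)
  have "rainbow_colouring ?\<Gamma> k ?c"
    unfolding rainbow_colouring_def
  proof (intro conjI ballI impI)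
    show "?c ` uedges ?\<Gamma> \<subseteq> {1..k}"
    proof
      fix n assume "n \<in> ?c ` uedges ?\<Gamma>"
      then obtain e where e: "e \<in> uedges ?\<Gamma>" "n = Suc (\<zeta> e)" by auto
      then have "\<zeta> e \<in> {i. i < k}" using im by (metis imageI)
      then show "n \<in> {1..k}" using e by auto
    qed
  next
    fix u v assume uv: "u \<in> pverts ?\<Gamma>" "v \<in> pverts ?\<Gamma>" "u \<noteq> v"
    then have c: "u \<in> carrier G" "v \<in> carrier G" by (auto simp: enhanced_power_graph_def)
    show "\<exists>p. rainbow_path ?\<Gamma> ?c p \<and> hd p = u \<and> last p = v"
    proof (cases "u = \<one> \<or> v = \<one>")
      case True
      then show ?thesis using uv c arc[of u v]
        by (intro exI[of _ "[u, v]"]) (auto simp: rainbow_path_def vpath_def vwalk_def)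
    next
      case False
      then have a: "(u, \<one>) \<in> parcs ?\<Gamma>" "(\<one>, v) \<in> parcs ?\<Gamma>" using c arc by auto
      have "\<zeta> {u, \<one>} \<noteq> \<zeta> {\<one>, v}"
        using inj_onD[OF inj _ edge[OF a(1)] edge[OF a(2)]] uv False by (auto simp: doubleton_eq_iff)
      moreover have "\<one> \<in> pverts ?\<Gamma>" by (simp add: enhanced_power_graph_def)
      ultimately show ?thesis using uv a False
        by (intro exI[of _ "[u, \<one>, v]"]) (auto simp: rainbow_path_def vpath_def vwalk_def)
    qed
  qed
  then show ?thesis by blast
qed

end

theory Submission
  imports Defs "HOL-Algebra.Multiplicative_Group" "HOL-Computational_Algebra.Primes"
begin

text \<open>
  Both sides of the equivalence hold. Let \<open>C\<close> be the maximal cyclic subgroup that meets all others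
  trivially. If all other maximal cyclic subgroups met each other nontrivially, then \<open>C\<close> would be
  normal and would contain the centralizer of each of its nontrivial elements, and this would force
  any two elements outside \<open>C\<close> to commute. But for \<open>a\<close> outside \<open>C\<close> and a generator \<open>c\<close> of \<open>C\<close>,
  both \<open>a\<close> and \<open>a c\<close> lie outside \<open>C\<close>, so \<open>a\<close> would centralize \<open>c\<close>. Hence there are three maximal
  cyclic subgroups with pairwise trivial intersections. In an awning and in a rainbow 2-colouring
  alike, these would assign to the identity three pairwise different values out of only two. On the
  other hand, a rainbow 3-colouring always exists.
\<close>

section \<open>Cyclic subgroups, conjugation and commuting elements\<close>

context group
begin

lemma generate_singleton_int_pow:
  assumes "a \<in> carrier G"
  shows "x \<in> generate G {a} \<longleftrightarrow> (\<exists>k::int. x = a [^] k)"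
  using generate_pow[OF assms] by auto

lemma generate_singleton_mono:
  assumes "b \<in> carrier G" "a \<in> generate G {b}"
  shows "generate G {a} \<subseteq> generate G {b}"
  using generate_subgroup_incl[of "{a}" "generate G {b}"] generate_is_subgroup[of "{b}"] assms
  by auto

lemma mem_generate_singleton: "a \<in> generate G {a}"
  by (simp add: generate.incl)

lemma generate_singleton_carrier:
  assumes "b \<in> carrier G" "a \<in> generate G {b}"
  shows "a \<in> carrier G"
  using generate_incl[of "{b}"] assms by auto

lemma conj_hom:
  assumes "g \<in> carrier G"
  shows "(\<lambda>x. g \<otimes> x \<otimes> inv g) \<in> hom G G"
proof (rule homI)
  fix x y assume xy: "x \<in> carrier G" "y \<in> carrier G"
  have "(g \<otimes> x \<otimes> inv g) \<otimes> (g \<otimes> y \<otimes> inv g) = g \<otimes> x \<otimes> (inv g \<otimes> g) \<otimes> y \<otimes> inv g"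
    using assms xy by (simp only: m_assoc m_closed inv_closed)
  then show "g \<otimes> (x \<otimes> y) \<otimes> inv g = (g \<otimes> x \<otimes> inv g) \<otimes> (g \<otimes> y \<otimes> inv g)"
    using assms xy by (simp add: m_assoc)
qed (use assms in auto)

lemma conj_mem_generate_singleton:
  assumes "g \<in> carrier G" "d \<in> carrier G" "x \<in> generate G {d}"
  shows "g \<otimes> x \<otimes> inv g \<in> generate G {g \<otimes> d \<otimes> inv g}"
proof -
  let ?f = "\<lambda>x. g \<otimes> x \<otimes> inv g"
  interpret group_hom G G ?f
    using conj_hom[OF assms(1)] by unfold_locales
  have "?f ` generate G {d} = generate G {?f d}"
    using generate_img[of "{d}"] assms by simp
  then show ?thesis using assms(3) by blast
qed

lemma commute_mult:
  assumes "z \<in> carrier G" "a \<in> carrier G" "b \<in> carrier G" "z \<otimes> a = a \<otimes> z" "z \<otimes> b = b \<otimes> z"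
  shows "z \<otimes> (a \<otimes> b) = a \<otimes> b \<otimes> z"
proof -
  have "z \<otimes> (a \<otimes> b) = (z \<otimes> a) \<otimes> b" using assms(1-3) by (simp add: m_assoc)
  also have "\<dots> = a \<otimes> (z \<otimes> b)" unfolding assms(4) using assms(1-3) by (simp add: m_assoc)
  also have "\<dots> = a \<otimes> b \<otimes> z" unfolding assms(5) using assms(1-3) by (simp add: m_assoc)
  finally show ?thesis .
qed

lemma commute_generate:
  assumes "x \<in> carrier G" "y \<in> carrier G" "x \<otimes> y = y \<otimes> x" "z \<in> generate G {x}"
  shows "z \<otimes> y = y \<otimes> z"
  using assms(4)
proof (induction rule: generate.induct)
  case (inv h)
  then have "h = x" by simp
  have "inv x \<otimes> y = inv x \<otimes> y \<otimes> (x \<otimes> inv x)"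
    using assms by simp
  also have "\<dots> = inv x \<otimes> (y \<otimes> x) \<otimes> inv x"
    using assms by (simp only: m_assoc m_closed inv_closed)
  also have "\<dots> = inv x \<otimes> (x \<otimes> y) \<otimes> inv x"
    using assms by simp
  also have "\<dots> = (inv x \<otimes> x) \<otimes> y \<otimes> inv x"
    using assms by (simp only: m_assoc m_closed inv_closed)
  finally show ?case using assms \<open>h = x\<close> by simp
next
  case (eng h1 h2)
  have c: "h1 \<in> carrier G" "h2 \<in> carrier G"
    using eng generate_singleton_carrier assms(1) by auto
  have "h1 \<otimes> h2 \<otimes> y = (h1 \<otimes> y) \<otimes> h2" using c eng.IH(2) assms(2) by (simp add: m_assoc)
  also have "\<dots> = y \<otimes> (h1 \<otimes> h2)" unfolding eng.IH(1) using c assms(2) by (simp add: m_assoc)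
  finally show ?case .
qed (use assms in auto)

lemma commute_in_generate_singleton:
  assumes "e \<in> carrier G" "u \<in> generate G {e}" "v \<in> generate G {e}"
  shows "u \<otimes> v = v \<otimes> u"
proof -
  have "u \<otimes> e = e \<otimes> u" using commute_generate[of e e u] assms by blast
  then show ?thesis using commute_generate[of e u v] assms generate_singleton_carrier by metis
qed

text \<open>Reduces questions about nontrivial elements to prime order: for a prime divisor
  \<open>p\<close> of \<open>ord x\<close>, the power of \<open>x\<close> with exponent
  \<open>ord x\<close> / \<open>p\<close> has order \<open>p\<close>.\<close>

lemma ex_prime_ord_in_generate:
  assumes fin: "finite (carrier G)" and x: "x \<in> carrier G" "x \<noteq> \<one>"
  obtains y p where "y \<in> generate G {x}" "prime p" "ord y = p"
proof -
  have "ord x \<noteq> 1" using x ord_eq_1 by blast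
  moreover have "ord x \<noteq> 0" using ord_ge_1[OF fin x(1)] by simp
  ultimately obtain p where p: "prime p" "p dvd ord x"
    using prime_factor_nat by blast
  then obtain n where n: "ord x = n * p" by (metis dvd_def mult.commute)
  have "ord (x [^] n) = p"
    using ord_pow_gen[OF x(1), of n] n \<open>ord x \<noteq> 0\<close> by auto
  moreover have "x [^] n \<in> generate G {x}"
    using generate_singleton_int_pow[OF x(1)] by (metis int_pow_int)
  ultimately show ?thesis using p that by blast
qed

text \<open>A cyclic group has at most one subgroup of order \<open>p\<close>: the exponents of
  \<open>z\<close> and \<open>w\<close> are multiples of \<open>n\<close> = \<open>ord e\<close> /
  \<open>p\<close>, and the cofactor belonging to \<open>w\<close> is invertible modulo
  \<open>p\<close>.\<close>

lemma prime_ord_generate_eq: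
  assumes p: "prime p" and e: "e \<in> carrier G"
    and z: "z \<in> generate G {e}" "ord z = p" and w: "w \<in> generate G {e}" "ord w = p"
  shows "z \<in> generate G {w}"
proof -
  obtain i j :: int where ij: "z = e [^] i" "w = e [^] j"
    using z w generate_singleton_int_pow[OF e] by metis
  have c: "z \<in> carrier G" "w \<in> carrier G" using ij e by simp_all
  then have zw: "z [^] int p = \<one>" "w [^] int p = \<one>"
    using z w by (simp_all add: int_pow_eq_id)
  have "w \<noteq> \<one>" using w p by auto
  have d: "int (ord e) dvd i * int p" "int (ord e) dvd j * int p"
    using zw(1,2) ij e by (simp_all add: int_pow_pow int_pow_eq_id)
  have nd: "\<not> int (ord e) dvd j" using \<open>w \<noteq> \<one>\<close> ij(2) int_pow_eq_id[OF e] by blast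
  \<comment> \<open>Otherwise \<open>ord e\<close> would divide \<open>j\<close> itself, making
    \<open>w\<close> trivial.\<close>
  have "p dvd ord e"
  proof (rule ccontr)
    assume "\<not> p dvd ord e"
    then have "coprime (int (ord e)) (int p)"
      using prime_imp_coprime[OF p] coprime_commute coprime_int_iff by blast
    then show False using d nd by (simp add: coprime_dvd_mult_left_iff)
  qed
  then obtain n where n: "ord e = n * p" by (metis dvd_def mult.commute)
  have "int n dvd i" "int n dvd j" using d n p by (auto simp: prime_gt_0_nat)
  then obtain i' j' where i': "i = int n * i'" "j = int n * j'" by (auto elim!: dvdE)
  have "\<not> int p dvd j'" using nd n i' by auto
  then have "coprime (int p) j'"
    using p prime_imp_coprime[of "int p" j'] by simp
  \<comment> \<open>\<open>u\<close> inverts \<open>j'\<close> modulo \<open>p\<close>, so the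
    exponent \<open>j * (u * i')\<close> agrees with \<open>i\<close> modulo
    \<open>ord e\<close>.\<close>
  then obtain u v where uv: "j' * u + int p * v = 1"
    using bezout_int[of j' "int p"] by (auto simp: coprime_iff_gcd_eq_1 gcd.commute mult.commute)
  have "z = e [^] (j * (u * i') + int (ord e) * (v * i'))"
  proof -
    have "j * (u * i') + int (ord e) * (v * i') = int n * i' * (j' * u + int p * v)"
      using n i' by (simp add: algebra_simps)
    then show ?thesis using ij i' uv by simp
  qed
  also have "\<dots> = e [^] (j * (u * i')) \<otimes> e [^] (int (ord e) * (v * i'))"
    by (rule int_pow_mult) (rule e)
  also have "e [^] (int (ord e) * (v * i')) = \<one>"
    using e by (simp add: int_pow_eq_id)
  finally have "z = w [^] (u * i')" using ij e by (simp add: int_pow_pow)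
  then show ?thesis using generate_singleton_int_pow[of w] ij e by auto
qed

end

section \<open>Groups with an isolated cyclic subgroup and a linked complement\<close>

text \<open>Here \<open>c\<close> stands for the only member of \<open>ics G M\<close>, and
  \<open>linked\<close> for the absence of two further generators that would complete a pairwise
  trivial triple. A nontrivial finite cyclic group with generator \<open>c\<close> satisfies all
  assumptions, so the outcome is \<open>C_eq_carrier\<close> and not a contradiction.\<close>

locale linked_isolated_cyclic = group +
  fixes c
  assumes finite_carrier: "finite (carrier G)"
    and c_carrier: "c \<in> carrier G" and c_neq_one: "c \<noteq> \<one>"
    and isolated: "\<And>w y. \<lbrakk>w \<in> carrier G; y \<in> generate G {w}; y \<in> generate G {c}; y \<noteq> \<one>\<rbrakk>
      \<Longrightarrow> w \<in> generate G {c}"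
    and linked: "\<And>a b. \<lbrakk>a \<in> carrier G; a \<notin> generate G {c}; b \<in> carrier G; b \<notin> generate G {c}\<rbrakk>
      \<Longrightarrow> \<exists>d\<in>carrier G. \<exists>d'\<in>carrier G. a \<in> generate G {d} \<and> b \<in> generate G {d'} \<and>
        (\<exists>z. z \<in> generate G {d} \<and> z \<in> generate G {d'} \<and> z \<noteq> \<one>)"
begin

abbreviation "C \<equiv> generate G {c}"

lemma subgroup_C: "subgroup C G"
  using generate_is_subgroup[of "{c}"] c_carrier by simp

lemma C_carrier: "x \<in> C \<Longrightarrow> x \<in> carrier G"
  using generate_singleton_carrier c_carrier by blast

lemma mult_left_mem_C_iff:
  assumes "x \<in> C" "g \<in> carrier G"
  shows "x \<otimes> g \<in> C \<longleftrightarrow> g \<in> C"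
proof
  assume "x \<otimes> g \<in> C"
  then have "inv x \<otimes> (x \<otimes> g) \<in> C"
    using subgroup.m_inv_closed[OF subgroup_C assms(1)] subgroup.m_closed[OF subgroup_C] by blast
  then show "g \<in> C" using C_carrier assms by (simp add: m_assoc[symmetric])
qed (use assms subgroup.m_closed[OF subgroup_C] in blast)

lemma mult_right_mem_C_iff:
  assumes "x \<in> C" "g \<in> carrier G"
  shows "g \<otimes> x \<in> C \<longleftrightarrow> g \<in> C"
proof
  assume "g \<otimes> x \<in> C"
  then have "(g \<otimes> x) \<otimes> inv x \<in> C"
    using subgroup.m_inv_closed[OF subgroup_C assms(1)] subgroup.m_closed[OF subgroup_C] by blast
  then show "g \<in> C" using C_carrier assms by (simp add: m_assoc)
qed (use assms subgroup.m_closed[OF subgroup_C] in blast)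

text \<open>If \<open>c' = g c g\<^sup>-\<^sup>1\<close> were outside \<open>C\<close>, then \<open>c c'\<close> would lie in neither \<open>C\<close> nor \<open>\<langle>c'\<rangle>\<close>,
  although linking \<open>c'\<close> with \<open>c c'\<close> and conjugating back forces it into \<open>\<langle>c'\<rangle>\<close>.\<close>

lemma conj_c_mem_C:
  assumes g: "g \<in> carrier G"
  shows "g \<otimes> c \<otimes> inv g \<in> C"
proof (rule ccontr)
  define c' where "c' = g \<otimes> c \<otimes> inv g"
  assume "g \<otimes> c \<otimes> inv g \<notin> C"
  then have nc': "c' \<notin> C" by (simp add: c'_def)
  have c': "c' \<in> carrier G" using g c_carrier by (simp add: c'_def)
  have cC: "c \<in> C" by (rule mem_generate_singleton)
  define a where "a = c \<otimes> c'"
  have a: "a \<in> carrier G" using c' c_carrier by (simp add: a_def)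
  have aC: "a \<notin> C" using mult_left_mem_C_iff[OF cC c'] nc' by (simp add: a_def)
  \<comment> \<open>Were \<open>a\<close> in the subgroup generated by \<open>c'\<close>, so would
    be \<open>c\<close>, and isolation would put \<open>c'\<close> into \<open>C\<close>.\<close>
  have aC': "a \<notin> generate G {c'}"
  proof
    assume "a \<in> generate G {c'}"
    moreover have "inv c' \<in> generate G {c'}" by (simp add: generate.inv)
    ultimately have "a \<otimes> inv c' \<in> generate G {c'}" by (rule generate.eng)
    then have "c \<in> generate G {c'}" using c' c_carrier by (simp add: a_def m_assoc)
    then show False using isolated[OF c' _ cC c_neq_one] nc' by blast
  qed
  \<comment> \<open>Conjugation by \<open>inv g\<close> carries the subgroup generated by
    \<open>c'\<close> to \<open>C\<close>, so this subgroup inherits isolation.\<close>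
  have in_conj: "d \<in> generate G {c'}"
    if d: "d \<in> carrier G" and yd: "y \<in> generate G {d}" "y \<in> generate G {c'}" "y \<noteq> \<one>" for d y
  proof -
    have yc: "y \<in> carrier G" using yd d generate_singleton_carrier by blast
    define k where "k = inv g"
    have k: "k \<in> carrier G" "inv k = g" using g by (auto simp: k_def)
    have "k \<otimes> c' \<otimes> inv k = c"
      unfolding c'_def k_def using g c_carrier by (simp add: m_assoc) (simp add: m_assoc[symmetric])
    then have "k \<otimes> y \<otimes> inv k \<in> C"
      using conj_mem_generate_singleton[OF k(1) c', of y] yd by simp
    moreover have "k \<otimes> y \<otimes> inv k \<noteq> \<one>"
    proof
      assume "k \<otimes> y \<otimes> inv k = \<one>"
      then have "inv k \<otimes> (k \<otimes> y \<otimes> inv k) \<otimes> k = \<one>" using k(1) by simp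
      then have "(inv k \<otimes> k) \<otimes> y \<otimes> (inv k \<otimes> k) = \<one>" using k(1) yc
        by (simp only: m_assoc m_closed inv_closed)
      then show False using yd(3) k(1) yc by simp
    qed
    ultimately have kd: "k \<otimes> d \<otimes> inv k \<in> C"
      using isolated[of "k \<otimes> d \<otimes> inv k" "k \<otimes> y \<otimes> inv k"] conj_mem_generate_singleton[OF k(1) d yd(1)]
        k g d by simp
    have "g \<otimes> (k \<otimes> d \<otimes> inv k) \<otimes> inv g = (g \<otimes> inv g) \<otimes> d \<otimes> (g \<otimes> inv g)"
      unfolding k_def using g d by (simp only: m_assoc m_closed inv_closed inv_inv)
    then have "g \<otimes> (k \<otimes> d \<otimes> inv k) \<otimes> inv g = d" using g d by simp
    then show "d \<in> generate G {c'}"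
      using conj_mem_generate_singleton[OF g c_carrier kd] by (simp add: c'_def)
  qed
  obtain d d' z where d: "d \<in> carrier G" "d' \<in> carrier G" "c' \<in> generate G {d}" "a \<in> generate G {d'}"
    "z \<in> generate G {d}" "z \<in> generate G {d'}" "z \<noteq> \<one>"
    using linked[OF c' nc' a aC] by blast
  have "c' \<noteq> \<one>" using nc' generate.one by metis
  \<comment> \<open>The inherited isolation absorbs \<open>d\<close> because of \<open>c'\<close>
    itself, then \<open>d'\<close> because of the link \<open>z\<close>, and with \<open>d'\<close>
    also \<open>a\<close>.\<close>
  then have "d \<in> generate G {c'}"
    using in_conj[OF d(1) d(3)] mem_generate_singleton by blast
  then have "z \<in> generate G {c'}" using generate_singleton_mono[OF c'] d by blast
  then have "d' \<in> generate G {c'}" using in_conj[OF d(2) d(6)] d by blast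
  then have "a \<in> generate G {c'}" using generate_singleton_mono[OF c'] d by blast
  then show False using aC' by blast
qed

text \<open>Since \<open>p\<close> and \<open>q\<close> are different primes, the
  \<open>q\<close>-th power of \<open>x \<otimes> z\<close> equals that of \<open>x\<close>, a
  nontrivial element of \<open>C\<close>. Isolation therefore pulls \<open>x \<otimes> z\<close>
  into \<open>C\<close>.\<close>

lemma mem_C_if_commutes_coprime:
  assumes x: "x \<in> C" "ord x = p" "prime p" and z: "z \<in> carrier G" "ord z = q" "prime q"
    and "p \<noteq> q" and comm: "z \<otimes> x = x \<otimes> z"
  shows "z \<in> C"
proof -
  have xc: "x \<in> carrier G" using x C_carrier by blast
  have "(x \<otimes> z) [^] q = x [^] q \<otimes> z [^] q"
    using pow_mult_distrib[of x z q] comm xc z by simp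
  also have "\<dots> = x [^] q" using z xc by (metis pow_ord_eq_1 r_one nat_pow_closed)
  finally have eq: "(x \<otimes> z) [^] q = x [^] q" .
  have "\<not> p dvd q" using primes_dvd_imp_eq assms by blast
  then have "x [^] q \<noteq> \<one>" using xc x pow_eq_id by auto
  moreover have "x [^] q \<in> C"
    using generate_singleton_mono[OF c_carrier x(1)] generate_singleton_int_pow[OF xc] int_pow_int by (metis subset_iff)
  moreover have "x [^] q \<in> generate G {x \<otimes> z}"
    using eq generate_singleton_int_pow[of "x \<otimes> z"] xc z int_pow_int m_closed by metis
  ultimately have "x \<otimes> z \<in> C" using isolated[of "x \<otimes> z" "x [^] q"] xc z by simp
  then show ?thesis using mult_left_mem_C_iff x z by blast
qed

text \<open>For \<open>g\<close> outside \<open>C\<close>, linking produces \<open>z\<close> and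
  \<open>w\<close> of order \<open>p\<close> outside \<open>C\<close> such that both
  \<open>z\<close> and \<open>z \<otimes> x\<close> are powers of \<open>w\<close>. Then
  \<open>x\<close> is a power of \<open>w\<close> as well, against isolation.\<close>

lemma centralizer_prime_ord:
  assumes x: "x \<in> C" "ord x = p" "prime p" and g: "g \<in> carrier G" "g \<otimes> x = x \<otimes> g"
  shows "g \<in> C"
proof (rule ccontr)
  assume ng: "g \<notin> C"
  have xc: "x \<in> carrier G" using x C_carrier by blast
  have x1: "x \<noteq> \<one>" using x by auto
  \<comment> \<open>A link between \<open>g\<close> and \<open>g \<otimes> x\<close> commutes with
    both, hence with \<open>x\<close>. Passing to a power \<open>w\<close> of prime order, the
    preceding lemma excludes every order other than \<open>p\<close>.\<close>
  have step: "\<exists>e e' w. e \<in> carrier G \<and> e' \<in> carrier G \<and> g \<in> generate G {e} \<and> g \<otimes> x \<in> generate G {e'} \<and>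
      w \<in> generate G {e} \<and> w \<in> generate G {e'} \<and> w \<in> carrier G \<and> w \<notin> C \<and> ord w = p \<and> w \<otimes> x = x \<otimes> w"
    if g: "g \<in> carrier G" "g \<otimes> x = x \<otimes> g" and ng: "g \<notin> C" for g
  proof -
    have gx: "g \<otimes> x \<in> carrier G" "g \<otimes> x \<notin> C" using g(1) ng xc mult_right_mem_C_iff[OF x(1) g(1)] by auto
    then obtain d d' z where d: "d \<in> carrier G" "d' \<in> carrier G" "g \<in> generate G {d}"
      "g \<otimes> x \<in> generate G {d'}" "z \<in> generate G {d}" "z \<in> generate G {d'}" "z \<noteq> \<one>"
      using linked[OF g(1) ng] by blast
    have zc: "z \<in> carrier G" using d generate_singleton_carrier by blast
    obtain w q where w: "w \<in> generate G {z}" "prime q" "ord w = q"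
      using ex_prime_ord_in_generate[OF finite_carrier zc d(7)] by blast
    have wc: "w \<in> carrier G" using w zc generate_singleton_carrier by blast
    have wd: "w \<in> generate G {d}" "w \<in> generate G {d'}"
      using generate_singleton_mono[OF d(1,5)] generate_singleton_mono[OF d(2,6)] w(1) by blast+
    have w1: "w \<noteq> \<one>" using w by auto
    have wC: "w \<notin> C"
    proof
      assume "w \<in> C"
      then have "d \<in> C" using isolated[OF d(1) wd(1)] w1 by blast
      then show False using d(3) ng generate_singleton_mono[OF c_carrier] by blast
    qed
    have "w \<otimes> g = g \<otimes> w" "w \<otimes> (g \<otimes> x) = (g \<otimes> x) \<otimes> w"
      using commute_in_generate_singleton[OF d(1) wd(1) d(3)]
        commute_in_generate_singleton[OF d(2) wd(2) d(4)] by simp_all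
    then have "g \<otimes> (w \<otimes> x) = g \<otimes> (x \<otimes> w)"
      using g(1) wc xc by (simp only: m_assoc[symmetric])
    then have wx: "w \<otimes> x = x \<otimes> w" using g(1) wc xc by simp
    have "q = p"
      using mem_C_if_commutes_coprime[OF x wc w(3,2) _ wx] wC by blast
    then show ?thesis using d(1-4) wd wC wc w(3) wx by blast
  qed
  \<comment> \<open>The first pass replaces \<open>g\<close> by an element \<open>z\<close> of order
    \<open>p\<close>. The second starts from \<open>z\<close>, so that \<open>z\<close>,
    \<open>z \<otimes> x\<close> and the link \<open>w\<close> all have order \<open>p\<close> and
    uniqueness of the subgroup of order \<open>p\<close> applies inside both cyclic groups.\<close>
  obtain z where z: "z \<in> carrier G" "z \<notin> C" "ord z = p" "z \<otimes> x = x \<otimes> z"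
    using step[OF g ng] by (elim exE conjE)
  obtain e e' w where e: "e \<in> carrier G" "e' \<in> carrier G" "z \<in> generate G {e}" "z \<otimes> x \<in> generate G {e'}"
     "w \<in> generate G {e}" "w \<in> generate G {e'}" "w \<in> carrier G" "w \<notin> C" "ord w = p"
    using step[OF z(1,4,2)] by (elim exE conjE)
  have zx: "z \<otimes> x \<in> carrier G" "z \<otimes> x \<notin> C" using z xc mult_right_mem_C_iff[OF x(1) z(1)] by auto
  have "z [^] p = \<one>" "x [^] p = \<one>"
    using pow_ord_eq_1[OF z(1)] pow_ord_eq_1[OF xc] z(3) x(2) by simp_all
  then have "(z \<otimes> x) [^] p = \<one>" using pow_mult_distrib[OF z(4,1) xc, of p] by simp
  then have "ord (z \<otimes> x) dvd p" using pow_eq_id[OF zx(1)] by blast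
  moreover have "ord (z \<otimes> x) \<noteq> 1"
    using zx(2) ord_eq_1[OF zx(1)] generate.one[of G "{c}"] by auto
  ultimately have "ord (z \<otimes> x) = p" using x(3) prime_nat_iff by blast
  then have "z \<otimes> x \<in> generate G {w}" "z \<in> generate G {w}"
    using prime_ord_generate_eq[OF x(3) e(2,4) _ e(6,9)] prime_ord_generate_eq[OF x(3) e(1,3) z(3) e(5,9)]
    by simp_all
  then have "inv z \<otimes> (z \<otimes> x) \<in> generate G {w}"
    using generate.eng[OF generate_m_inv_closed[of "{w}" z]] e(7) by simp
  then have "x \<in> generate G {w}" using z(1) xc by (simp add: m_assoc[symmetric])
  then show False using isolated[OF e(7) _ x(1) x1] e(8) by blast
qed

text \<open>Whatever commutes with \<open>x\<close> commutes with its powers, among them one of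
  prime order.\<close>

lemma centralizer_subset_C:
  assumes x: "x \<in> C" "x \<noteq> \<one>" and g: "g \<in> carrier G" "g \<otimes> x = x \<otimes> g"
  shows "g \<in> C"
proof -
  have xc: "x \<in> carrier G" using x C_carrier by blast
  obtain y p where y: "y \<in> generate G {x}" "prime p" "ord y = p"
    using ex_prime_ord_in_generate[OF finite_carrier xc x(2)] by blast
  have "y \<otimes> g = g \<otimes> y" using commute_generate[OF xc g(1) _ y(1)] g by simp
  moreover have "y \<in> C" using generate_singleton_mono[OF c_carrier x(1)] y by blast
  ultimately show ?thesis using centralizer_prime_ord y g by metis
qed

text \<open>The conjugation action on \<open>C\<close> is by power maps, so \<open>a b\<close> and \<open>b a\<close> differ by an element of the
  centralizer of \<open>C\<close>; that element commutes with the link between \<open>a\<close> and \<open>b\<close>, which lies outside \<open>C\<close>.\<close>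

lemma commute_outside_C:
  assumes a: "a \<in> carrier G" "a \<notin> C" and b: "b \<in> carrier G" "b \<notin> C"
  shows "a \<otimes> b = b \<otimes> a"
proof -
  obtain d d' z where d: "d \<in> carrier G" "d' \<in> carrier G" "a \<in> generate G {d}"
      "b \<in> generate G {d'}" "z \<in> generate G {d}" "z \<in> generate G {d'}" "z \<noteq> \<one>"
    using linked[OF a b] by blast
  have zc: "z \<in> carrier G" using d generate_singleton_carrier by blast
  have zC: "z \<notin> C"
  proof
    assume "z \<in> C"
    then have "d \<in> C" using isolated[OF d(1,5)] d by blast
    then show False using d a generate_singleton_mono[OF c_carrier] by blast
  qed
  have za: "z \<otimes> a = a \<otimes> z" and zb: "z \<otimes> b = b \<otimes> z" using commute_in_generate_singleton d by blast+
  \<comment> \<open>Conjugation by \<open>g\<close> sends \<open>c\<close> to some power with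
    exponent \<open>k\<close>, and it multiplies every exponent by this same
    \<open>k\<close>.\<close>
  have conj_pow: "\<exists>k::int. \<forall>l::int. g \<otimes> c [^] l = c [^] (k * l) \<otimes> g" if g: "g \<in> carrier G" for g
  proof -
    obtain k :: int where k: "g \<otimes> c \<otimes> inv g = c [^] k"
      using conj_c_mem_C[OF g] generate_singleton_int_pow[OF c_carrier] by blast
    have "g \<otimes> c [^] l = c [^] (k * l) \<otimes> g" for l :: int
    proof -
      have "g \<otimes> c [^] l \<otimes> inv g = (g \<otimes> c \<otimes> inv g) [^] l"
        using hom_int_pow[OF conj_hom[OF g], of c l] c_carrier is_group by simp
      then have "g \<otimes> c [^] l \<otimes> inv g \<otimes> g = c [^] (k * l) \<otimes> g"
        using k c_carrier by (simp add: int_pow_pow)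
      then show ?thesis using g c_carrier by (simp add: m_assoc)
    qed
    then show ?thesis by blast
  qed
  obtain k l :: int where k: "\<forall>n::int. a \<otimes> c [^] n = c [^] (k * n) \<otimes> a"
    and l: "\<forall>n::int. b \<otimes> c [^] n = c [^] (l * n) \<otimes> b"
    using conj_pow a b by metis
  have ab: "a \<otimes> b \<otimes> c = c [^] (k * l) \<otimes> (a \<otimes> b)"
  proof -
    have "a \<otimes> b \<otimes> c = a \<otimes> (b \<otimes> c [^] (1::int))" using a b c_carrier by (simp add: m_assoc)
    also have "\<dots> = (a \<otimes> c [^] l) \<otimes> b" using l[rule_format, of 1] a b c_carrier by (simp add: m_assoc)
    finally show ?thesis using k a b c_carrier by (simp add: m_assoc)
  qed
  \<comment> \<open>Exponents multiply commutatively, so \<open>b \<otimes> a\<close> moves past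
    \<open>c\<close> with the same exponent as \<open>a \<otimes> b\<close>.\<close>
  have ba: "b \<otimes> a \<otimes> c = c [^] (k * l) \<otimes> (b \<otimes> a)"
  proof -
    have "b \<otimes> a \<otimes> c = b \<otimes> (a \<otimes> c [^] (1::int))" using a b c_carrier by (simp add: m_assoc)
    also have "\<dots> = (b \<otimes> c [^] k) \<otimes> a" using k[rule_format, of 1] a b c_carrier by (simp add: m_assoc)
    finally show ?thesis using l a b c_carrier by (simp add: m_assoc mult.commute)
  qed
  \<comment> \<open>The factor by which the two products differ; the equal exponents make it commute
    with \<open>c\<close>.\<close>
  define h where "h = inv (b \<otimes> a) \<otimes> (a \<otimes> b)"
  have h: "h \<in> carrier G" using a b by (simp add: h_def)
  have abh: "b \<otimes> a \<otimes> h = a \<otimes> b" using a b unfolding h_def by (simp add: m_assoc[symmetric])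
  have "b \<otimes> a \<otimes> (h \<otimes> c) = b \<otimes> a \<otimes> (c \<otimes> h)"
  proof -
    have "b \<otimes> a \<otimes> (h \<otimes> c) = a \<otimes> b \<otimes> c" using abh a b h c_carrier by (simp add: m_assoc[symmetric])
    also have "\<dots> = c [^] (k * l) \<otimes> (b \<otimes> a \<otimes> h)" using ab abh by simp
    also have "\<dots> = (b \<otimes> a \<otimes> c) \<otimes> h" using ba a b h c_carrier by (simp add: m_assoc)
    finally show ?thesis using a b h c_carrier by (simp add: m_assoc)
  qed
  then have "h \<otimes> c = c \<otimes> h" using a b h c_carrier by simp
  then have hC: "h \<in> C" using centralizer_subset_C mem_generate_singleton c_neq_one h by blast
  have "b \<otimes> a \<otimes> (h \<otimes> z) = b \<otimes> a \<otimes> (z \<otimes> h)"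
  proof -
    have "b \<otimes> a \<otimes> (h \<otimes> z) = a \<otimes> b \<otimes> z" using abh a b h zc by (simp add: m_assoc[symmetric])
    also have "\<dots> = z \<otimes> (a \<otimes> b)" using commute_mult[OF zc a(1) b(1) za zb] by simp
    also have "\<dots> = (z \<otimes> (b \<otimes> a)) \<otimes> h" using abh a b h zc by (simp add: m_assoc)
    also have "z \<otimes> (b \<otimes> a) = (b \<otimes> a) \<otimes> z" by (rule commute_mult[OF zc b(1) a(1) zb za])
    also have "(b \<otimes> a) \<otimes> z \<otimes> h = b \<otimes> a \<otimes> (z \<otimes> h)" using a b h zc by (simp add: m_assoc)
    finally show ?thesis .
  qed
  then have "z \<otimes> h = h \<otimes> z" using a b h zc by simp
  \<comment> \<open>The centralizer of a nontrivial \<open>h\<close> would lie in \<open>C\<close>,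
    yet it contains \<open>z\<close>.\<close>
  then have "h = \<one>" using centralizer_subset_C[OF hC _ zc] zC by blast
  then show ?thesis using abh a b by simp
qed

lemma C_eq_carrier: "C = carrier G"
proof (rule ccontr)
  assume "C \<noteq> carrier G"
  then obtain a where a: "a \<in> carrier G" "a \<notin> C" using C_carrier by blast
  have cC: "c \<in> C" by (rule mem_generate_singleton)
  have ac: "a \<otimes> c \<in> carrier G" "a \<otimes> c \<notin> C"
    using a c_carrier mult_right_mem_C_iff[OF cC] by auto
  have "a \<otimes> (a \<otimes> c) = a \<otimes> (c \<otimes> a)"
    using commute_outside_C[OF a ac] a c_carrier by (simp add: m_assoc)
  then have "a \<otimes> c = c \<otimes> a" using a c_carrier by simp
  then show False using centralizer_subset_C[OF cC c_neq_one a(1)] a(2) by blast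
qed

end

section \<open>Pairwise trivial triples exclude awnings\<close>

text \<open>All three of \<open>h i j\<close>, \<open>h i k\<close> and \<open>h j k\<close> are the
  identity. Whichever of \<open>A i\<close> and \<open>B i\<close> contains it, the case
  \<open>r = j\<close> forces it into the opposite part at \<open>j\<close> and the case
  \<open>r = k\<close> into the like-named one.\<close>

lemma awning_no_pairwise_trivial:
  assumes aw: "awning G m x h A B" and ijk: "1 \<le> i" "i < j" "j < k" "k \<le> m"
    and triv: "generate G {x i} \<inter> generate G {x j} = {\<one>\<^bsub>G\<^esub>}"
      "generate G {x i} \<inter> generate G {x k} = {\<one>\<^bsub>G\<^esub>}"
      "generate G {x j} \<inter> generate G {x k} = {\<one>\<^bsub>G\<^esub>}"
  shows False
proof -
  have i: "i \<in> {1..m-1}" "i \<in> {1..<j}" and j: "j \<in> {1..m-1}" "j \<in> {2..m-1}" "j \<in> {i+1..m}"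
    and k: "k \<in> {j+1..m}" "k \<in> {i+1..m}"
    using ijk by auto
  have parts: "h n ` {n+1..m} = A n \<union> B n \<and> A n \<inter> B n = {}"
    and mem: "\<And>l. l \<in> {n+1..m} \<Longrightarrow> h n l \<in> generate G {x n} \<inter> generate G {x l}"
    if "n \<in> {1..m-1}" for n
    using aw that unfolding awning_def by blast+
  have cond: "(r = j \<and> h i r \<in> A i \<longrightarrow> h j k \<in> B j) \<and>
        (r = j \<and> h i r \<in> B i \<longrightarrow> h j k \<in> A j) \<and>
        (r = k \<and> h i r \<in> A i \<longrightarrow> h j r \<in> A j) \<and>
        (r = k \<and> h i r \<in> B i \<longrightarrow> h j r \<in> B j)"
    if "h j k = h i r" "r \<in> {i+1..m}" for r
    using aw that i(2) j(2) k(1) unfolding awning_def by blast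
  have h: "h i j = \<one>\<^bsub>G\<^esub>" "h i k = \<one>\<^bsub>G\<^esub>" "h j k = \<one>\<^bsub>G\<^esub>"
    using mem[OF i(1) j(3)] mem[OF i(1) k(2)] mem[OF j(1) k(1)] triv by auto
  have "h i j \<in> h i ` {i+1..m}" using j(3) by blast
  then have "\<one>\<^bsub>G\<^esub> \<in> A i \<or> \<one>\<^bsub>G\<^esub> \<in> B i" using parts[OF i(1)] h by auto
  then have "\<one>\<^bsub>G\<^esub> \<in> A j \<and> \<one>\<^bsub>G\<^esub> \<in> B j"
    using cond[of j, OF _ j(3)] cond[of k, OF _ k(2)] h by auto
  then show False using parts[OF j(1)] by blast
qed

text \<open>Awning conditions depend on the order of the indices, and a triple may occur in the
  enumeration of \<open>M\<close> in any order.\<close>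

lemma sort_three:
  fixes p q r :: "'i::linorder"
  assumes "p \<noteq> q" "q \<noteq> r" "p \<noteq> r"
  shows "\<exists>i j k. i < j \<and> j < k \<and> {i, j, k} \<subseteq> {p, q, r}"
proof -
  consider "p < q" "q < r" | "p < r" "r < q" | "q < p" "p < r" | "q < r" "r < p"
    | "r < p" "p < q" | "r < q" "q < p"
    using assms by (meson linorder_neqE order.strict_trans)
  then show ?thesis by cases blast+
qed

text \<open>Quantifying over all ordered pairs keeps the condition invariant under permutation, as
  needed once the positions are sorted.\<close>

definition pairwise_trivial_triple :: "('a, 'b) monoid_scheme \<Rightarrow> 'a set \<Rightarrow> 'a \<Rightarrow> 'a \<Rightarrow> 'a \<Rightarrow> bool" where
  "pairwise_trivial_triple G M a b c \<longleftrightarrow> {a, b, c} \<subseteq> M \<and> a \<noteq> b \<and> b \<noteq> c \<and> a \<noteq> c \<and>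
     (\<forall>u\<in>{a, b, c}. \<forall>v\<in>{a, b, c}. u \<noteq> v \<longrightarrow> generate G {u} \<inter> generate G {v} = {\<one>\<^bsub>G\<^esub>})"

lemma pairwise_trivial_triple_no_awning:
  assumes "pairwise_trivial_triple G M a b c"
  shows "\<not> has_awning G M"
proof
  assume "has_awning G M"
  then obtain x h A B where x: "bij_betw x {1..card M} M" and aw: "awning G (card M) x h A B"
    unfolding has_awning_def by blast
  have "x ` {1..card M} = M" using x by (simp add: bij_betw_def)
  then have "a \<in> x ` {1..card M}" "b \<in> x ` {1..card M}" "c \<in> x ` {1..card M}"
    using assms by (auto simp: pairwise_trivial_triple_def)
  then obtain p q r where pqr: "p \<in> {1..card M}" "q \<in> {1..card M}" "r \<in> {1..card M}"
    "a = x p" "b = x q" "c = x r"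
    by blast
  have "p \<noteq> q" "q \<noteq> r" "p \<noteq> r" using assms pqr by (auto simp: pairwise_trivial_triple_def)
  then obtain i j k where ijk: "i < j" "j < k" "{i, j, k} \<subseteq> {p, q, r}"
    using sort_three by metis
  have triv: "generate G {x u} \<inter> generate G {x v} = {\<one>\<^bsub>G\<^esub>}"
    if "u \<in> {p, q, r}" "v \<in> {p, q, r}" "u \<noteq> v" for u v
  proof -
    have "x u \<noteq> x v" using x that pqr(1-3) unfolding bij_betw_def inj_on_def by blast
    moreover have "x u \<in> {a, b, c}" "x v \<in> {a, b, c}" using that pqr by auto
    ultimately show ?thesis using assms unfolding pairwise_trivial_triple_def by blast
  qed
  have "i \<in> {1..card M}" "k \<in> {1..card M}" using ijk(3) pqr(1-3) by auto
  then show False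
    using awning_no_pairwise_trivial[OF aw _ ijk(1,2)] triv ijk by auto
qed

section \<open>Maximal cyclic subgroups and adjacency\<close>

context group
begin

lemma essential_cyclic_set_cover:
  assumes fin: "finite (carrier G)" and M: "essential_cyclic_set G M" and g: "g \<in> carrier G"
  obtains y where "y \<in> M" "g \<in> generate G {y}"
proof -
  let ?X = "{D \<in> cyclic_subgroups G. g \<in> D}"
  have "finite ?X" using fin by (simp add: cyclic_subgroups_def)
  moreover have "generate G {g} \<in> ?X"
    using g mem_generate_singleton by (auto simp: cyclic_subgroups_def)
  ultimately obtain D where D: "D \<in> ?X" and max: "\<And>E. E \<in> ?X \<Longrightarrow> D \<subseteq> E \<Longrightarrow> D = E"
    using finite_has_maximal[of ?X] by blast
  \<comment> \<open>Every cyclic subgroup above \<open>D\<close> still contains \<open>g\<close>, so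
    maximality among those containing \<open>g\<close> is maximality among all.\<close>
  have "D \<in> maximal_cyclic_subgroups G"
    using D max unfolding maximal_cyclic_subgroups_def by blast
  then obtain y where "y \<in> M" "D = generate G {y}"
    using M unfolding essential_cyclic_set_def bij_betw_def by blast
  then show ?thesis using that D by blast
qed

lemma essential_cyclic_set_antichain:
  assumes M: "essential_cyclic_set G M" and y: "y \<in> M" "y' \<in> M" "y' \<in> generate G {y}"
  shows "y' = y"
proof -
  have "y \<in> carrier G" "y' \<in> carrier G" using M y by (auto simp: essential_cyclic_set_def)
  then have "generate G {y'} \<subseteq> generate G {y}" "generate G {y} \<in> cyclic_subgroups G"
    using generate_singleton_mono y by (auto simp: cyclic_subgroups_def)
  moreover have "generate G {y'} \<in> maximal_cyclic_subgroups G"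
    using M y by (auto simp: essential_cyclic_set_def bij_betw_def)
  ultimately have "generate G {y'} = generate G {y}"
    by (auto simp: maximal_cyclic_subgroups_def)
  then show ?thesis using M y by (auto simp: essential_cyclic_set_def bij_betw_def inj_on_def)
qed

text \<open>The cyclic group witnessing the edge extends to one generated by some \<open>m\<close>
  in \<open>M\<close>, and since it contains \<open>y\<close>, the antichain property forces
  \<open>m = y\<close>.\<close>

lemma essential_cyclic_set_adjacent:
  assumes fin: "finite (carrier G)" and M: "essential_cyclic_set G M"
    and y: "y \<in> M" and arc: "(y, w) \<in> parcs (enhanced_power_graph G)"
  shows "w \<in> generate G {y}"
proof -
  obtain z where z: "z \<in> carrier G" "y \<in> generate G {z}" "w \<in> generate G {z}"
    using arc by (auto simp: enhanced_power_graph_def)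
  obtain m where m: "m \<in> M" "z \<in> generate G {m}"
    using essential_cyclic_set_cover[OF fin M z(1)] by blast
  have "m \<in> carrier G" using m M by (auto simp: essential_cyclic_set_def)
  then have "generate G {z} \<subseteq> generate G {m}" using generate_singleton_mono m by blast
  then show ?thesis using essential_cyclic_set_antichain[OF M m(1) y] z by blast
qed

lemma parcs_sym:
  "(u, v) \<in> parcs (enhanced_power_graph G) \<longleftrightarrow> (v, u) \<in> parcs (enhanced_power_graph G)"
  by (auto simp: enhanced_power_graph_def)

section \<open>Existence of a pairwise trivial triple\<close>

text \<open>Without a triple, any two members of \<open>M\<close> other than \<open>c\<close> meet
  nontrivially, which supplies the locale assumptions. Then \<open>c\<close> generates the whole
  group, leaving no room for another member of \<open>M\<close>.\<close>

lemma ex_pairwise_trivial_triple: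
  assumes fin: "finite (carrier G)" and M: "essential_cyclic_set G M"
    and card: "card M \<ge> 3" and ics: "ics G M = {c}"
  shows "\<exists>a b. pairwise_trivial_triple G M a b c"
proof (rule ccontr)
  assume no: "\<nexists>a b. pairwise_trivial_triple G M a b c"
  have Mc: "M \<subseteq> carrier G" using M by (simp add: essential_cyclic_set_def)
  have c: "c \<in> M" and triv: "\<And>y. y \<in> M \<Longrightarrow> y \<noteq> c \<Longrightarrow> generate G {c} \<inter> generate G {y} = {\<one>}"
    using ics unfolding ics_def by blast+
  have nontriv: "generate G {y} \<inter> generate G {y'} \<noteq> {\<one>}"
    if "y \<in> M" "y' \<in> M" "y \<noteq> c" "y' \<noteq> c" "y \<noteq> y'" for y y'
  proof
    assume t: "generate G {y} \<inter> generate G {y'} = {\<one>}"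
    have "pairwise_trivial_triple G M y y' c"
      unfolding pairwise_trivial_triple_def
      using that c t triv[of y] triv[of y'] by (auto simp: Int_commute)
    then show False using no by blast
  qed
  have "M \<noteq> {c}" using card by auto
  then obtain y0 where y0: "y0 \<in> M" "y0 \<noteq> c" using c by blast
  have anti: "y' = y" if "y \<in> M" "y' \<in> M" "y' \<in> generate G {y}" for y y'
    using essential_cyclic_set_antichain[OF M that] .
  have outside: "\<exists>m\<in>M. m \<noteq> c \<and> a \<in> generate G {m}"
    if "a \<in> carrier G" "a \<notin> generate G {c}" for a
    using essential_cyclic_set_cover[OF fin M that(1)] that(2) by metis
  interpret linked_isolated_cyclic G c
  proof
    show "finite (carrier G)" by (rule fin)
    show "c \<in> carrier G" using c Mc by blast
    \<comment> \<open>The identity lies in every cyclic subgroup, so as a member of \<open>M\<close>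
      it would coincide with \<open>y0\<close>.\<close>
    show "c \<noteq> \<one>"
      using anti[OF y0(1) c] y0(2) generate.one[of G "{y0}"] by metis
  next
    fix w y assume w: "w \<in> carrier G" "y \<in> generate G {w}" "y \<in> generate G {c}" "y \<noteq> \<one>"
    show "w \<in> generate G {c}"
    proof (rule ccontr)
      assume "w \<notin> generate G {c}"
      then obtain m where m: "m \<in> M" "m \<noteq> c" "w \<in> generate G {m}" using outside w by blast
      then have "y \<in> generate G {m}" using generate_singleton_mono[of m w] Mc w by blast
      then show False using triv[OF m(1,2)] w by blast
    qed
  next
    fix a b assume ab: "a \<in> carrier G" "a \<notin> generate G {c}" "b \<in> carrier G" "b \<notin> generate G {c}"
    then obtain d d' where d: "d \<in> M" "d \<noteq> c" "a \<in> generate G {d}" "d' \<in> M" "d' \<noteq> c" "b \<in> generate G {d'}"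
      using outside by metis
    have "\<exists>z. z \<in> generate G {d} \<and> z \<in> generate G {d'} \<and> z \<noteq> \<one>"
    proof (cases "d = d'")
      case True
      \<comment> \<open>Inside a single maximal cyclic subgroup, \<open>a\<close> itself serves as
        the link.\<close>
      have "a \<noteq> \<one>" using ab(2) generate.one by metis
      then show ?thesis using True d by blast
    next
      case False
      then show ?thesis using nontriv[OF d(1,4,2,5)] generate.one by blast
    qed
    then show "\<exists>d\<in>carrier G. \<exists>d'\<in>carrier G. a \<in> generate G {d} \<and> b \<in> generate G {d'} \<and>
        (\<exists>z. z \<in> generate G {d} \<and> z \<in> generate G {d'} \<and> z \<noteq> \<one>)"
      using d Mc by blast
  qed
  have "y0 \<in> generate G {c}" using C_eq_carrier y0 Mc by blast
  then show False using anti[OF c y0(1)] y0(2) by blast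
qed

section \<open>Lower bound for rainbow colourings\<close>

text \<open>With at most two colours, rainbow paths have at most two edges. Members of the triple
  are not adjacent and have only the identity as common neighbour, so their edges to the identity
  need three different colours.\<close>

lemma pairwise_trivial_triple_no_rainbow:
  assumes fin: "finite (carrier G)" and M: "essential_cyclic_set G M"
    and triple: "pairwise_trivial_triple G M a b c"
    and col: "rainbow_colouring (enhanced_power_graph G) k \<zeta>"
  shows "k \<ge> 3"
proof (rule ccontr)
  assume k: "\<not> k \<ge> 3"
  let ?\<Gamma> = "enhanced_power_graph G"
  have Mc: "M \<subseteq> carrier G" using M by (simp add: essential_cyclic_set_def)
  have colk: "\<zeta> {u, v} \<in> {1..k}" if "(u, v) \<in> parcs ?\<Gamma>" for u v
    using col that unfolding rainbow_colouring_def uedges_def by force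
  have diff: "\<zeta> {u, \<one>} \<noteq> \<zeta> {v, \<one>} \<and> \<zeta> {u, \<one>} \<in> {1..k} \<and> \<zeta> {v, \<one>} \<in> {1..k}"
    if uvs: "u \<in> {a, b, c}" "v \<in> {a, b, c}" "u \<noteq> v" for u v
  proof -
    have uv: "u \<in> M" "v \<in> M" and triv: "generate G {u} \<inter> generate G {v} = {\<one>}"
      using triple that unfolding pairwise_trivial_triple_def by blast+
    have "u \<in> pverts ?\<Gamma>" "v \<in> pverts ?\<Gamma>"
      using uv Mc by (auto simp: enhanced_power_graph_def)
    then obtain p where p: "rainbow_path ?\<Gamma> \<zeta> p" "hd p = u" "last p = v"
      using col uvs(3) unfolding rainbow_colouring_def by blast
    have arcs: "set (vwalk_arcs p) \<subseteq> parcs ?\<Gamma>" and ne: "p \<noteq> []"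
      using p(1) by (auto simp: rainbow_path_def vpath_def vwalk_def)
    let ?cs = "map (\<lambda>(u, v). \<zeta> {u, v}) (vwalk_arcs p)"
    have cs: "distinct ?cs" using p(1) by (simp add: rainbow_path_def)
    have "set ?cs \<subseteq> {1..k}" using arcs colk by auto
    then have "card (set ?cs) \<le> k" using card_mono[of "{1..k}" "set ?cs"] by simp
    then have "length (vwalk_arcs p) \<le> k" using distinct_card[OF cs] by simp
    then have "length p \<le> 3" using k vwalk_length_simp[of p, unfolded vwalk_length_def] by linarith
    then consider w where "p = [w]" | "p = [u, v]" | w where "p = [u, w, v]"
      using ne p(2,3) by (cases p rule: vwalk_arcs.cases; cases "tl (tl p)"; cases "tl (tl (tl p))") auto
    then show ?thesis
    proof cases
      case 1
      then show ?thesis using p that by simp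
    next
      case 2
      then have "(u, v) \<in> parcs ?\<Gamma>" using arcs by simp
      then have "v \<in> generate G {u}" using essential_cyclic_set_adjacent[OF fin M uv(1)] by blast
      then show ?thesis using essential_cyclic_set_antichain[OF M uv] that by blast
    next
      case (3 w)
      then have a: "(u, w) \<in> parcs ?\<Gamma>" "(w, v) \<in> parcs ?\<Gamma>" using arcs by auto
      then have "w \<in> generate G {u}" "w \<in> generate G {v}"
        using essential_cyclic_set_adjacent[OF fin M] uv parcs_sym by blast+
      then have "w = \<one>" using triv by blast
      then show ?thesis using 3 a cs colk[of u \<one>] colk[of \<one> v] by (auto simp: insert_commute)
    qed
  qed
  have "a \<noteq> b" "b \<noteq> c" "a \<noteq> c" using triple by (auto simp: pairwise_trivial_triple_def)
  then show False using diff[of a b] diff[of b c] diff[of a c] k by auto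
qed

section \<open>Upper bound by an explicit colouring\<close>

text \<open>Edges at \<open>\<one>\<close> get colour 2 if their other end lies in several maximal cyclic subgroups and
  colour 1 otherwise; all remaining edges get colour 3.\<close>

lemma ex_rainbow_colouring_3:
  assumes fin: "finite (carrier G)" and M: "essential_cyclic_set G M"
    and card: "card M \<ge> 2" and ics: "ics G M \<subseteq> {c}"
  shows "\<exists>\<zeta>. rainbow_colouring (enhanced_power_graph G) 3 \<zeta>"
proof -
  let ?\<Gamma> = "enhanced_power_graph G"
  have Mc: "M \<subseteq> carrier G" using M by (simp add: essential_cyclic_set_def)
  define S where "S = {w. \<exists>y\<in>M. \<exists>y'\<in>M. y \<noteq> y' \<and> w \<in> generate G {y} \<and> w \<in> generate G {y'}}"
  \<comment> \<open>The identity belongs to \<open>S\<close>; without removing it, every edge at the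
    identity would get colour 2.\<close>
  define \<zeta> :: "'a set \<Rightarrow> nat" where
    "\<zeta> e = (if \<one> \<in> e then if e \<inter> (S - {\<one>}) \<noteq> {} then 2 else 1 else 3)" for e
  have anti: "y' = y" if "y \<in> M" "y' \<in> M" "y' \<in> generate G {y}" for y y'
    using essential_cyclic_set_antichain[OF M that] .
  have MS: "y \<notin> S" if "y \<in> M" for y using anti that by (auto simp: S_def)
  have "\<exists>y\<in>M. \<exists>y'\<in>M. y \<noteq> y'"
    using card card_le_Suc0_iff_eq[of M] finite_subset[OF Mc fin] by force
  then have oneS: "\<one> \<in> S" using generate.one by (auto simp: S_def)
  have arc: "(u, v) \<in> parcs ?\<Gamma>"
    if "y \<in> carrier G" "u \<in> generate G {y}" "v \<in> generate G {y}" "u \<noteq> v" for u v y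
    using that generate_singleton_carrier by (auto simp: enhanced_power_graph_def)
  have arc1: "(u, \<one>) \<in> parcs ?\<Gamma>" "(\<one>, u) \<in> parcs ?\<Gamma>" if "u \<in> carrier G" "u \<noteq> \<one>" for u
    using arc[of u u \<one>] arc[of u \<one> u] that mem_generate_singleton generate.one by auto
  have Scol: "\<zeta> {\<one>, u} = 2" "\<zeta> {u, \<one>} = 2" if "u \<in> S" "u \<noteq> \<one>" for u
    using that by (auto simp: \<zeta>_def)
  have nScol: "\<zeta> {\<one>, u} = 1" "\<zeta> {u, \<one>} = 1" if "u \<notin> S" for u
    using that by (auto simp: \<zeta>_def)
  have col3: "\<zeta> {u, v} = 3" if "u \<noteq> \<one>" "v \<noteq> \<one>" for u v
    using that by (auto simp: \<zeta>_def)
  have path3: "rainbow_path ?\<Gamma> \<zeta> [u, \<one>, v]"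
    if "u \<in> carrier G" "v \<in> carrier G" "u \<noteq> \<one>" "v \<noteq> \<one>" "u \<noteq> v" "\<zeta> {u, \<one>} \<noteq> \<zeta> {\<one>, v}" for u v
    using that arc1 by (auto simp: rainbow_path_def vpath_def vwalk_def enhanced_power_graph_def)
  \<comment> \<open>The edge from \<open>u\<close> to \<open>w\<close> has colour 3, and those
    joining \<open>w\<close> and \<open>v\<close> to the identity have colours 1 and 2 in some
    order. The reversed path serves detours at the far end.\<close>
  have path4: "rainbow_path ?\<Gamma> \<zeta> [u, w, \<one>, v] \<and> rainbow_path ?\<Gamma> \<zeta> [v, \<one>, w, u]"
    if "(u, w) \<in> parcs ?\<Gamma>" "v \<in> carrier G" "u \<noteq> \<one>" "w \<noteq> \<one>" "v \<noteq> \<one>" "u \<noteq> v" "w \<noteq> v"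
      "w \<in> S \<longleftrightarrow> v \<notin> S" for u v w
  proof -
    have c: "u \<in> carrier G" "w \<in> carrier G" "u \<noteq> w" "(w, u) \<in> parcs ?\<Gamma>"
      using that(1) by (auto simp: enhanced_power_graph_def)
    have cols: "\<zeta> {u, w} = 3" "\<zeta> {w, u} = 3" "\<zeta> {w, \<one>} \<noteq> \<zeta> {\<one>, v}" "\<zeta> {v, \<one>} \<noteq> \<zeta> {\<one>, w}"
      "\<zeta> {w, \<one>} \<noteq> 3" "\<zeta> {\<one>, w} \<noteq> 3" "\<zeta> {v, \<one>} \<noteq> 3" "\<zeta> {\<one>, v} \<noteq> 3"
      using col3[of u w] col3[of w u] Scol[of w] Scol[of v] nScol[of w] nScol[of v] that by force+
    have v: "pverts ?\<Gamma> = carrier G" by (simp add: enhanced_power_graph_def)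
    show ?thesis
      unfolding rainbow_path_def vpath_def vwalk_def
      using that(1-7) c arc1[of w] arc1[of v] cols v by auto
  qed
  \<comment> \<open>As \<open>y\<close> is not in \<open>ics G M\<close>, its subgroup meets another
    maximal one nontrivially; a nontrivial common element lies in \<open>S\<close> and is adjacent
    to \<open>u\<close>.\<close>
  have via_S: "\<exists>w. w \<in> S \<and> w \<noteq> \<one> \<and> (u, w) \<in> parcs ?\<Gamma>"
    if u: "u \<in> generate G {y}" "u \<notin> S" and y: "y \<in> M" "y \<noteq> c" for u y
  proof -
    obtain y' where y': "y' \<in> M" "y' \<noteq> y" "generate G {y} \<inter> generate G {y'} \<noteq> {\<one>}"
      using ics y unfolding ics_def by blast
    then obtain w where w: "w \<in> generate G {y}" "w \<in> generate G {y'}" "w \<noteq> \<one>"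
      using generate.one by blast
    then have "w \<in> S" using y y' unfolding S_def by blast
    then show ?thesis using arc[of y u w] w u y Mc by blast
  qed
  have "rainbow_colouring ?\<Gamma> 3 \<zeta>"
    unfolding rainbow_colouring_def
  proof (intro conjI ballI impI)
    show "\<zeta> ` uedges ?\<Gamma> \<subseteq> {1..3}" by (auto simp: \<zeta>_def)
  next
    fix u v assume "u \<in> pverts ?\<Gamma>" "v \<in> pverts ?\<Gamma>" and ne: "u \<noteq> v"
    then have uv: "u \<in> carrier G" "v \<in> carrier G" by (auto simp: enhanced_power_graph_def)
    show "\<exists>p. rainbow_path ?\<Gamma> \<zeta> p \<and> hd p = u \<and> last p = v"
    proof (cases "(u, v) \<in> parcs ?\<Gamma>")
      case True
      then show ?thesis using uv ne
        by (intro exI[of _ "[u, v]"])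
          (auto simp: rainbow_path_def vpath_def vwalk_def enhanced_power_graph_def)
    next
      case False
      have n1: "u \<noteq> \<one>" "v \<noteq> \<one>" using False arc1 uv ne by auto
      obtain y where y: "y \<in> M" "u \<in> generate G {y}"
        using essential_cyclic_set_cover[OF fin M uv(1)] by blast
      obtain y' where y': "y' \<in> M" "v \<in> generate G {y'}"
        using essential_cyclic_set_cover[OF fin M uv(2)] by blast
      have nv: "v \<notin> generate G {y}" using arc[of y u v] y False Mc ne by blast
      consider "u \<in> S \<longleftrightarrow> v \<notin> S" | "u \<in> S" "v \<in> S" | "u \<notin> S" "v \<notin> S" by blast
      then show ?thesis
      proof cases
        case 1
        then have "rainbow_path ?\<Gamma> \<zeta> [u, \<one>, v]"
          using path3[OF uv n1 ne] Scol[of u] Scol[of v] nScol[of u] nScol[of v] n1 by force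
        then show ?thesis by (intro exI[of _ "[u, \<one>, v]"]) simp
      next
        case 2
        \<comment> \<open>Both edges to the identity have colour 2. A detour through the generator
          \<open>y\<close>, which lies in no second maximal cyclic subgroup, turns the first of them
          into one of colour 1.\<close>
        have yS: "y \<notin> S" using MS y by blast
        have "(u, y) \<in> parcs ?\<Gamma>"
          using arc[of y u y] y Mc yS 2 mem_generate_singleton by blast
        moreover have "y \<noteq> \<one>" "y \<noteq> v" using yS oneS 2 by auto
        ultimately have "rainbow_path ?\<Gamma> \<zeta> [u, y, \<one>, v]"
          using path4[of u y v] uv n1 ne yS 2 by blast
        then show ?thesis by (intro exI[of _ "[u, y, \<one>, v]"]) simp
      next
        case 3
        \<comment> \<open>Both edges to the identity have colour 1. At least one of \<open>y\<close>
          and \<open>y'\<close> differs from \<open>c\<close>, and on that side a detour through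
          \<open>S\<close> is available.\<close>
        have "y \<noteq> y'" using nv y' by blast
        then consider "y \<noteq> c" | "y' \<noteq> c" by blast
        then show ?thesis
        proof cases
          case 1
          obtain w where "w \<in> S" "w \<noteq> \<one>" "(u, w) \<in> parcs ?\<Gamma>"
            using via_S[OF y(2) 3(1) y(1) 1] by blast
          then have "rainbow_path ?\<Gamma> \<zeta> [u, w, \<one>, v]" using path4[of u w v] uv n1 ne 3 by blast
          then show ?thesis by (intro exI[of _ "[u, w, \<one>, v]"]) simp
        next
          case 2
          obtain w where "w \<in> S" "w \<noteq> \<one>" "(v, w) \<in> parcs ?\<Gamma>"
            using via_S[OF y'(2) 3(2) y'(1) 2] by blast
          then have "rainbow_path ?\<Gamma> \<zeta> [u, \<one>, w, v]" using path4[of v w u] uv n1 ne 3 by blast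
          then show ?thesis by (intro exI[of _ "[u, \<one>, w, v]"]) simp
        qed
      qed
    qed
  qed
  then show ?thesis by blast
qed

end

theorem theorem3p3:
  fixes G :: "('a, 'b) monoid_scheme" and M :: "'a set"
  assumes "group G" and "finite (carrier G)"
    and "essential_cyclic_set G M" and "card M \<ge> 3"
    and "icn G M = 1"
  shows "rc (enhanced_power_graph G) = 3 \<longleftrightarrow> \<not> has_awning G M"
proof -
  interpret group G by fact
  obtain c where c: "ics G M = {c}"
    using assms(5) unfolding icn_def by (auto simp: card_1_singleton_iff)
  obtain a b where triple: "pairwise_trivial_triple G M a b c"
    using ex_pairwise_trivial_triple[OF assms(2-4) c] by blast
  have "rc (enhanced_power_graph G) = 3"
    unfolding rc_def
  proof (rule Least_equality)
    show "\<exists>\<zeta>. rainbow_colouring (enhanced_power_graph G) 3 \<zeta>"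
      using ex_rainbow_colouring_3[OF assms(2,3)] assms(4) c by simp
  qed (use pairwise_trivial_triple_no_rainbow[OF assms(2,3) triple] in blast)
  then show ?thesis using pairwise_trivial_triple_no_awning[OF triple] by blast
qed

end
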